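(* Let $R$ be an associative ring with unit and $q \in R$. Assume that $R$ is $q$-flat and let $p$ be a positive integer. Then $q\text{-char}(R) = p$ if and only if one of the following conditions is satisfied: (1) $q$ is a non-trivial (i.e. $q \neq 1$) primitive $p$-th root of unity; (2) $q = 1$ and $\mathrm{Char}(R) = p$. In both cases, $q$ is a $p$-th root of unity and, in particular, it is invertible.
   Context: For $m \in \mathbb N$ (including $0$), $(m)_q := \sum_{i=0}^{m-1} q^i \in R$. The $q$-characteristic $q\text{-char}(R)$ is the smallest positive integer $p$ such that $(p)_q = 0$ if it exists, and $0$ otherwise. $R$ is $q$-flat if for all $m \in \mathbb N$ and $a \in R$, $(m)_q a = 0$ if and only if $(m)_q = 0$ or $a = 0$. A primitive $p$-th root of unity is an element $q \in R$ such that $p$ is the smallest positive integer $m$ with $q^m = 1$. $\mathrm{Char}(R)$ is the usual characteristic of $R$. *)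

theory Defs
  imports "HOL-Algebra.Ring"
begin

text \<open>Rings are those of the locale \<open>ring\<close>: associative with unit, possibly noncommutative, and
  possibly zero (the type class \<open>ring_1\<close> would exclude the zero ring).\<close>

definition q_number :: "('a, 'b) ring_scheme \<Rightarrow> 'a \<Rightarrow> nat \<Rightarrow> 'a"
  where "q_number R q m = (\<Oplus>\<^bsub>R\<^esub>i\<in>{..<m}. q [^]\<^bsub>R\<^esub> i)"

definition q_char :: "('a, 'b) ring_scheme \<Rightarrow> 'a \<Rightarrow> nat"
  where "q_char R q =
    (if \<exists>m>0. q_number R q m = \<zero>\<^bsub>R\<^esub> then LEAST m. 0 < m \<and> q_number R q m = \<zero>\<^bsub>R\<^esub> else 0)"

definition q_flat :: "('a, 'b) ring_scheme \<Rightarrow> 'a \<Rightarrow> bool"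
  where "q_flat R q \<longleftrightarrow>
    (\<forall>m. \<forall>a\<in>carrier R.
      q_number R q m \<otimes>\<^bsub>R\<^esub> a = \<zero>\<^bsub>R\<^esub> \<longleftrightarrow> q_number R q m = \<zero>\<^bsub>R\<^esub> \<or> a = \<zero>\<^bsub>R\<^esub>)"

definition primitive_root_of_unity :: "('a, 'b) ring_scheme \<Rightarrow> nat \<Rightarrow> 'a \<Rightarrow> bool"
  where "primitive_root_of_unity R p q \<longleftrightarrow>
    q \<in> carrier R \<and> 0 < p \<and> q [^]\<^bsub>R\<^esub> p = \<one>\<^bsub>R\<^esub> \<and>
    (\<forall>m. 0 < m \<and> m < p \<longrightarrow> q [^]\<^bsub>R\<^esub> m \<noteq> \<one>\<^bsub>R\<^esub>)"

text \<open>The library constant \<open>CHAR('a)\<close> is for type classes only. The zero ring has characteristic 1.\<close>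

definition ring_char :: "('a, 'b) ring_scheme \<Rightarrow> nat"
  where "ring_char R =
    (if \<exists>m::nat. 0 < m \<and> add_pow R m \<one>\<^bsub>R\<^esub> = \<zero>\<^bsub>R\<^esub>
     then LEAST m::nat. 0 < m \<and> add_pow R m \<one>\<^bsub>R\<^esub> = \<zero>\<^bsub>R\<^esub> else 0)"

end

theory Submission
  imports Defs "HOL-Algebra.Multiplicative_Group"
begin

text \<open>
  Everything rests on the telescoping identity \<open>(m)\<^sub>q (q - 1) = q\<^sup>m - 1\<close>
  (\<open>q_number_mult_minus_one\<close>), which holds in any ring because only powers of \<open>q\<close> occur.

  If \<open>q \<noteq> 1\<close>, flatness applied to \<open>a = q - 1\<close> makes this factor cancellable: \<open>(m)\<^sub>q\<close> vanishes
  exactly when \<open>q\<^sup>m = 1\<close> (\<open>q_number_eq_zero_iff\<close>). The \<open>q\<close>-characteristic and the order of \<open>q\<close>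
  are then least elements of the same set of exponents. If \<open>q = 1\<close>, then \<open>(m)\<^sub>q = m \<cdot> 1\<close>
  (\<open>q_number_one\<close>), and the \<open>q\<close>-characteristic is the characteristic by definition.

  In both cases \<open>q\<^sup>p = 1\<close> with \<open>p > 0\<close>, so \<open>q\<^sup>p\<^sup>-\<^sup>1\<close> is an inverse of \<open>q\<close>.
\<close>

text \<open>
  The common shape of both characteristics. For \<open>p > 0\<close> the default value \<open>0\<close> is excluded, and
  what remains is the minimality clause that also defines a primitive root of unity.
\<close>

lemma Least_or_zero_eq_iff:
  fixes p :: nat
  assumes "0 < p"
  shows "(if \<exists>m>0. P m then LEAST m. 0 < m \<and> P m else 0) = p
    \<longleftrightarrow> P p \<and> (\<forall>m. 0 < m \<and> m < p \<longrightarrow> \<not> P m)"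
proof
  assume eq: "(if \<exists>m>0. P m then LEAST m. 0 < m \<and> P m else 0) = p"
  with assms have ex: "\<exists>m. 0 < m \<and> P m" and p: "p = (LEAST m. 0 < m \<and> P m)"
    by (auto split: if_splits)
  show "P p \<and> (\<forall>m. 0 < m \<and> m < p \<longrightarrow> \<not> P m)"
    using LeastI_ex[OF ex] not_less_Least[of _ "\<lambda>m. 0 < m \<and> P m"] unfolding p by blast
next
  assume p: "P p \<and> (\<forall>m. 0 < m \<and> m < p \<longrightarrow> \<not> P m)"
  have "(LEAST m. 0 < m \<and> P m) = p"
    using p assms by (intro Least_equality) (auto simp: not_less[symmetric])
  with p assms show "(if \<exists>m>0. P m then LEAST m. 0 < m \<and> P m else 0) = p"
    by auto
qed

context ring
begin

lemma q_number_0: "q_number R q 0 = \<zero>"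
  by (simp add: q_number_def)

lemma q_number_Suc:
  assumes "q \<in> carrier R"
  shows "q_number R q (Suc m) = q [^] m \<oplus> q_number R q m"
  using assms unfolding q_number_def lessThan_Suc
  by (intro finsum_insert) auto

lemma q_number_closed:
  assumes "q \<in> carrier R"
  shows "q_number R q m \<in> carrier R"
  using assms by (auto simp: q_number_def intro: finsum_closed)

lemma q_number_one: "q_number R \<one> m = add_pow R m \<one>"
  by (induction m) (simp_all add: q_number_0 q_number_Suc a_comm)

text \<open>
  Adding \<open>q\<^sup>m\<close> to \<open>(m)\<^sub>q\<close> contributes \<open>q\<^sup>m\<^sup>+\<^sup>1 - q\<^sup>m\<close> to the product, so the sum telescopes.
\<close>

lemma q_number_mult_minus_one:
  assumes q: "q \<in> carrier R"
  shows "q_number R q m \<otimes> (q \<ominus> \<one>) = q [^] m \<ominus> \<one>"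
proof (induction m)
  case 0
  show ?case using q by (simp add: q_number_0 minus_eq r_neg)
next
  case (Suc m)
  have "q_number R q (Suc m) \<otimes> (q \<ominus> \<one>) = q [^] m \<otimes> (q \<ominus> \<one>) \<oplus> (q [^] m \<ominus> \<one>)"
    using q by (simp add: q_number_Suc q_number_closed l_distr Suc.IH)
  also have "\<dots> = (q [^] Suc m \<ominus> q [^] m) \<oplus> (q [^] m \<ominus> \<one>)"
    using q by (simp add: minus_eq r_distr r_minus)
  also have "\<dots> = q [^] Suc m \<ominus> \<one>"
    using q by (simp add: minus_eq a_assoc r_neg1)
  finally show ?case .
qed

text \<open>
  Flatness allows \<open>q - 1 \<noteq> 0\<close> to be cancelled from \<open>(m)\<^sub>q (q - 1) = q\<^sup>m - 1\<close>.
\<close>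

lemma q_number_eq_zero_iff:
  assumes q: "q \<in> carrier R" and flat: "q_flat R q" and "q \<noteq> \<one>"
  shows "q_number R q m = \<zero> \<longleftrightarrow> q [^] m = \<one>"
proof -
  have "q \<ominus> \<one> \<noteq> \<zero>"
    using q \<open>q \<noteq> \<one>\<close> by simp
  then have "q_number R q m = \<zero> \<longleftrightarrow> q_number R q m \<otimes> (q \<ominus> \<one>) = \<zero>"
    using q flat unfolding q_flat_def by simp
  also have "\<dots> \<longleftrightarrow> q [^] m = \<one>"
    using q by (simp add: q_number_mult_minus_one)
  finally show ?thesis .
qed

lemma q_char_eq_iff_primitive_root:
  assumes "q \<in> carrier R" and "q_flat R q" and "q \<noteq> \<one>" and "0 < p"
  shows "q_char R q = p \<longleftrightarrow> primitive_root_of_unity R p q"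
  using assms
  unfolding q_char_def Least_or_zero_eq_iff[OF \<open>0 < p\<close>]
  by (simp add: q_number_eq_zero_iff primitive_root_of_unity_def)

lemma q_char_one: "q_char R \<one> = ring_char R"
  unfolding q_char_def ring_char_def q_number_one ..

lemma root_of_unity_Units:
  assumes q: "q \<in> carrier R" and "0 < (p::nat)" and "q [^] p = \<one>"
  shows "q \<in> Units R"
proof -
  obtain n where n: "p = Suc n"
    using \<open>0 < p\<close> gr0_implies_Suc by blast
  have "q [^] n \<otimes> q = \<one>" and "q \<otimes> q [^] n = \<one>"
    using assms nat_pow_Suc2[OF q] unfolding n by simp_all
  with q show ?thesis
    unfolding Units_def by blast
qed

end

theorem proposition1p10:
  fixes R :: "('a, 'b) ring_scheme" (structure) and q :: 'a and p :: nat
  assumes "ring R" and "q \<in> carrier R" and "q_flat R q" and "0 < p"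
  shows "(q_char R q = p \<longleftrightarrow>
           (q \<noteq> \<one> \<and> primitive_root_of_unity R p q) \<or> (q = \<one> \<and> ring_char R = p)) \<and>
         ((q \<noteq> \<one> \<and> primitive_root_of_unity R p q) \<or> (q = \<one> \<and> ring_char R = p) \<longrightarrow>
           q [^] p = \<one> \<and> q \<in> Units R)"
proof -
  interpret ring R by fact
  show ?thesis
  proof (cases "q = \<one>")
    case True
    then show ?thesis by (simp add: q_char_one)
  next
    case False
    then show ?thesis
      using assms q_char_eq_iff_primitive_root root_of_unity_Units
      by (auto simp: primitive_root_of_unity_def)
  qed
qed

end
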